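(* Let $\lambda>0$, $\beta>0$, $\epsilon>0$ and a positive integer $\gamma$ be fixed with $0<\epsilon<\gamma^2\beta/4$, and for each $r>0$ let $(Y^r,X^r)$ be the continuous-time Markov chain described in the context. Then for all sufficiently large $r$ the Markov process $(Y^r,X^r)$ is positive recurrent, and the sequence of stationary distributions of the fluid-scaled processes $(\bar Y^r,\bar X^r)=r^{-1}(Y^r,X^r-\lambda r/\beta)$ converges weakly, as $r\to\infty$, to the Dirac measure concentrated at $(0,0)$.
   Context: Model: For scaling parameter $r>0$, the process $(Y^r(t),X^r(t))$, $t\ge0$, is a continuous-time Markov chain on $\mathbb{Z}\times\mathbb{Z}_+$ whose transitions from state $(Y,X)$ are: (i) at rate $\lambda r$: $Y\mapsto Y-1$, $X\mapsto X+\gamma$; (ii) at rate $\beta X$: $Y\mapsto Y+1$, $X\mapsto X-(\gamma\wedge X)$; (iii) at rate $\epsilon|Y|$: if $X\ge1$, $X\mapsto X-\mathrm{sgn}(Y)$ ($Y$ unchanged); if $X=0$, $X\mapsto X+1$ when $Y<0$ and no change when $Y\ge0$. Here $\mathrm{sgn}(z)=1,0,-1$ for $z>0$, $z=0$, $z<0$, and $a\wedge b=\min\{a,b\}$. *)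

theory Defs
  imports "HOL-Analysis.Analysis"
begin

text \<open>A CTMC is given by its off-diagonal transition rates Q s s' (s' \<noteq> s).\<close>

definition out_rate :: "('s \<Rightarrow> 's \<Rightarrow> real) \<Rightarrow> 's \<Rightarrow> real" where
  "out_rate Q s = (\<Sum>\<^sub>\<infinity> s'\<in>-{s}. Q s s')"

definition jump_prob :: "('s \<Rightarrow> 's \<Rightarrow> real) \<Rightarrow> 's \<Rightarrow> 's \<Rightarrow> real" where
  "jump_prob Q s s' = (if s' = s then 0 else Q s s' / out_rate Q s)"

definition excursions :: "'s \<Rightarrow> 's list set" where
  "excursions s = {zs. length zs \<ge> 2 \<and> hd zs = s \<and> last zs = s \<and>
                        (\<forall>i. 0 < i \<and> i < length zs - 1 \<longrightarrow> zs ! i \<noteq> s)}"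

definition path_prob :: "('s \<Rightarrow> 's \<Rightarrow> real) \<Rightarrow> 's list \<Rightarrow> real" where
  "path_prob Q zs = (\<Prod>i<length zs - 1. jump_prob Q (zs ! i) (zs ! Suc i))"

definition holding_time :: "('s \<Rightarrow> 's \<Rightarrow> real) \<Rightarrow> 's list \<Rightarrow> real" where
  "holding_time Q zs = (\<Sum>i<length zs - 1. 1 / out_rate Q (zs ! i))"

definition return_prob :: "('s \<Rightarrow> 's \<Rightarrow> real) \<Rightarrow> 's \<Rightarrow> ennreal" where
  "return_prob Q s = (\<Sum>\<^sub>\<infinity> zs\<in>excursions s. ennreal (path_prob Q zs))"

text \<open>Expected return time to s (starting from s), on the event of return.\<close>
definition mean_return_time :: "('s \<Rightarrow> 's \<Rightarrow> real) \<Rightarrow> 's \<Rightarrow> ennreal" where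
  "mean_return_time Q s =
     (\<Sum>\<^sub>\<infinity> zs\<in>excursions s. ennreal (path_prob Q zs * holding_time Q zs))"

definition pos_recurrent_state :: "('s \<Rightarrow> 's \<Rightarrow> real) \<Rightarrow> 's \<Rightarrow> bool" where
  "pos_recurrent_state Q s \<longleftrightarrow> return_prob Q s = 1 \<and> mean_return_time Q s < \<infinity>"

definition reachable :: "('s \<Rightarrow> 's \<Rightarrow> real) \<Rightarrow> 's \<Rightarrow> 's \<Rightarrow> bool" where
  "reachable Q = (\<lambda>a b. a \<noteq> b \<and> Q a b > 0)\<^sup>*\<^sup>*"

text \<open>Positive recurrence of the process: there is a positive recurrent state
  which is reachable from every state (the chain has transient states, so
  irreducibility on the whole state space cannot be required).\<close>
definition pos_recurrent :: "('s \<Rightarrow> 's \<Rightarrow> real) \<Rightarrow> bool" where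
  "pos_recurrent Q \<longleftrightarrow> (\<exists>s. pos_recurrent_state Q s \<and> (\<forall>s'. reachable Q s' s))"

definition stationary_dist :: "('s \<Rightarrow> 's \<Rightarrow> real) \<Rightarrow> ('s \<Rightarrow> real) \<Rightarrow> bool" where
  "stationary_dist Q \<pi> \<longleftrightarrow> (\<forall>s. \<pi> s \<ge> 0) \<and> (\<pi> has_sum 1) UNIV \<and>
     (\<forall>j. ((\<lambda>i. \<pi> i * Q i j) has_sum (\<pi> j * out_rate Q j)) (-{j}))"

text \<open>States (Y, X) in Z x Z_+. Transition rates from (y,x):
  (i) rate \<lambda> r to (y-1, x+\<gamma>);
  (ii) rate \<beta> x to (y+1, x - min \<gamma> x);
  (iii) rate \<epsilon> |y| to (y, x - sgn y) if x \<ge> 1, to (y, x+1) if x = 0 and y < 0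
        (no change otherwise).  The three targets are distinct and differ from (y,x).\<close>
definition model_rate ::
  "real \<Rightarrow> real \<Rightarrow> real \<Rightarrow> nat \<Rightarrow> real \<Rightarrow> int \<times> nat \<Rightarrow> int \<times> nat \<Rightarrow> real" where
  "model_rate lam bet eps gam r s s' =
     (case s of (y, x) \<Rightarrow>
        (if s' = (y - 1, x + gam) then lam * r else 0)
      + (if s' = (y + 1, x - min gam x) then bet * real x else 0)
      + (if y \<noteq> 0 \<and> (x \<ge> 1 \<or> y < 0) \<and> s' = (y, nat (int x - sgn y))
         then eps * real_of_int \<bar>y\<bar> else 0))"

definition fluid_scale :: "real \<Rightarrow> real \<Rightarrow> real \<Rightarrow> int \<times> nat \<Rightarrow> real \<times> real" where
  "fluid_scale lam bet r s =
     (case s of (y, x) \<Rightarrow> (real_of_int y / r, (real x - lam * r / bet) / r))"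

end

theory Submission
  imports Defs
begin

text \<open>
  With \<open>u = y\<close> and \<open>v = x - \<lambda> r / \<beta>\<close>, the function \<open>V = (\<gamma> u + v)\<^sup>2 + v\<^sup>2 + (2 \<epsilon> / \<beta>) u\<^sup>2\<close> has
  drift \<open>- 2 \<beta> \<gamma> v\<^sup>2 - 2 \<epsilon> \<gamma> u\<^sup>2\<close> plus terms that are linear in \<open>r\<close>, \<open>u\<close> and \<open>v\<close>, except on the
  boundary \<open>x = 0\<close>, \<open>y > 0\<close>, where only arrivals occur and the drift is
  \<open>- 2 \<lambda> r (\<gamma> \<lambda> r / \<beta> + (2 \<epsilon> / \<beta>) y)\<close> up to \<open>O(r)\<close>.

  Hence the drift is below minus the total jump rate off a finite set, so the embedded jump chain
  satisfies Foster's criterion; as the jump rates are bounded away from \<open>0\<close>, this gives positive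
  recurrence.  Moreover the drift is at most \<open>C (r + 1) - \<kappa> min (u\<^sup>2 + v\<^sup>2) r\<^sup>2\<close>, and its
  stationary mean cannot be negative, so the stationary expectation of
  \<open>min ((u\<^sup>2 + v\<^sup>2) / r\<^sup>2) 1\<close> is \<open>O(1 / r)\<close>.
\<close>

section \<open>Drift criteria for chains with locally finite rates\<close>

lemma has_sum_disjoint_UN_nonneg:
  fixes f :: "'b \<Rightarrow> real"
  assumes f: "\<And>x. x \<in> A \<Longrightarrow> (f has_sum g x) (B x)" and g: "(g has_sum S) A"
    and nonneg: "\<And>x y. x \<in> A \<Longrightarrow> y \<in> B x \<Longrightarrow> f y \<ge> 0"
    and disj: "disjoint_family_on B A"
  shows "(f has_sum S) (\<Union>x\<in>A. B x)"
proof -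
  have "((f \<circ> snd) has_sum S) (Sigma A B)"
  proof (rule has_sum_SigmaI[where g = g])
    show "(f \<circ> snd) summable_on Sigma A B"
      using f g nonneg by (intro summable_on_SigmaI[where g = g]) (auto dest: has_sum_imp_summable)
  qed (use f g in auto)
  moreover have "inj_on snd (Sigma A B)"
    using disj by (force simp: disjoint_family_on_def inj_on_def)
  moreover have "snd ` Sigma A B = (\<Union>x\<in>A. B x)"
    by force
  ultimately show ?thesis
    using has_sum_reindex[of snd "Sigma A B" f S] by simp
qed

lemma infsum_ennreal:
  fixes f :: "'a \<Rightarrow> real"
  assumes "f summable_on A" and "\<And>x. x \<in> A \<Longrightarrow> f x \<ge> 0"
  shows "(\<Sum>\<^sub>\<infinity>x\<in>A. ennreal (f x)) = ennreal (infsum f A)"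
proof -
  have "sum (ennreal \<circ> f) F = ennreal (sum f F)" if "F \<subseteq> A" for F
    using assms(2) that by (subst sum_ennreal[symmetric]) auto
  then have "infsum (ennreal \<circ> f) A = ennreal (infsum f A)"
    using assms(1) by (intro infsum_comm_additive_general) auto
  then show ?thesis by (simp add: o_def)
qed

definition generator :: "('s \<Rightarrow> 's \<Rightarrow> real) \<Rightarrow> ('s \<Rightarrow> real) \<Rightarrow> 's \<Rightarrow> real" where
  "generator Q h a = (\<Sum>b | Q a b \<noteq> 0. Q a b * (h b - h a))"

definition paths_to :: "'s \<Rightarrow> nat \<Rightarrow> 's \<Rightarrow> 's list set" where
  "paths_to s n a = {zs. length zs = n + 2 \<and> hd zs = a \<and> last zs = s \<and>
     (\<forall>i. 0 < i \<and> i < Suc n \<longrightarrow> zs ! i \<noteq> s)}"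

primrec first_hit_prob :: "('s \<Rightarrow> 's \<Rightarrow> real) \<Rightarrow> 's \<Rightarrow> nat \<Rightarrow> 's \<Rightarrow> real" where
  "first_hit_prob Q s 0 a = jump_prob Q a s"
| "first_hit_prob Q s (Suc n) a =
     (\<Sum>b\<in>{b. Q a b \<noteq> 0} - {s}. jump_prob Q a b * first_hit_prob Q s n b)"

primrec avoid_prob :: "('s \<Rightarrow> 's \<Rightarrow> real) \<Rightarrow> 's \<Rightarrow> nat \<Rightarrow> 's \<Rightarrow> real" where
  "avoid_prob Q s 0 a = 1"
| "avoid_prob Q s (Suc n) a =
     (\<Sum>b\<in>{b. Q a b \<noteq> 0} - {s}. jump_prob Q a b * avoid_prob Q s n b)"

lemma excursions_eq_UN_paths_to: "excursions s = (\<Union>n. paths_to s n s)"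
proof (intro set_eqI iffI)
  fix zs assume zs: "zs \<in> excursions s"
  then have "zs \<in> paths_to s (length zs - 2) s"
    by (auto simp: excursions_def paths_to_def)
  then show "zs \<in> (\<Union>n. paths_to s n s)" by blast
qed (auto simp: excursions_def paths_to_def)

lemma paths_to_0: "paths_to s 0 a = {[a, s]}"
proof -
  have "zs = [a, s]" if "length zs = 2" "hd zs = a" "last zs = s" for zs
    using that by (auto simp: length_Suc_conv numeral_2_eq_2)
  then show ?thesis by (auto simp: paths_to_def)
qed

lemma paths_to_Suc: "paths_to s (Suc n) a = (\<Union>b\<in>-{s}. (#) a ` paths_to s n b)"
proof (intro set_eqI iffI)
  fix zs assume zs: "zs \<in> paths_to s (Suc n) a"
  then obtain ws where ws: "zs = a # ws" "length ws = n + 2"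
    by (cases zs) (auto simp: paths_to_def)
  have avoid: "ws ! i \<noteq> s" if "i < Suc n" for i
    using zs that unfolding paths_to_def ws(1) by (auto dest: spec[of _ "Suc i"])
  have "hd ws = ws ! 0" using ws by (intro hd_conv_nth) auto
  with avoid[of 0] have "hd ws \<in> -{s}" by simp
  moreover have "ws \<in> paths_to s n (hd ws)"
    using zs ws avoid by (auto simp: paths_to_def split: if_splits)
  ultimately show "zs \<in> (\<Union>b\<in>-{s}. (#) a ` paths_to s n b)" using ws by auto
next
  fix zs assume "zs \<in> (\<Union>b\<in>-{s}. (#) a ` paths_to s n b)"
  then obtain b ws where b: "b \<noteq> s" "ws \<in> paths_to s n b" "zs = a # ws" by auto
  have ne: "ws \<noteq> []" using b by (auto simp: paths_to_def)
  have "(a # ws) ! i \<noteq> s" if "0 < i" "i < Suc (Suc n)" for i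
    using that b ne by (cases i; cases "i = 1") (auto simp: paths_to_def hd_conv_nth)
  then show "zs \<in> paths_to s (Suc n) a"
    using b ne by (auto simp: paths_to_def)
qed

lemma path_prob_Cons:
  assumes "zs \<noteq> []"
  shows "path_prob Q (a # zs) = jump_prob Q a (hd zs) * path_prob Q zs"
proof -
  obtain n where n: "length zs = Suc n" using assms by (cases zs) auto
  show ?thesis
    unfolding path_prob_def using assms n
    by (simp add: prod.lessThan_Suc_shift hd_conv_nth del: prod.lessThan_Suc)
qed

locale locally_finite_rates =
  fixes Q :: "'s \<Rightarrow> 's \<Rightarrow> real"
  assumes rate_nonneg: "Q a b \<ge> 0" and rate_diag: "Q a a = 0"
    and finite_succ: "finite {b. Q a b \<noteq> 0}" and finite_pred: "finite {a. Q a b \<noteq> 0}"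
    and out_rate_pos: "out_rate Q a > 0"
begin

lemma sum_rates_superset:
  assumes "finite T" "{b. Q a b \<noteq> 0} \<subseteq> T"
  shows "(\<Sum>b | Q a b \<noteq> 0. Q a b * f b) = (\<Sum>b\<in>T. Q a b * f b)"
  using assms by (intro sum.mono_neutral_left) auto

lemma out_rate_eq_sum: "out_rate Q a = (\<Sum>b | Q a b \<noteq> 0. Q a b)"
  unfolding out_rate_def
  by (intro infsumI has_sum_finite_neutralI[OF finite_succ]) (use rate_diag in auto)

lemma generator_eq: "generator Q h a = (\<Sum>b | Q a b \<noteq> 0. Q a b * h b) - out_rate Q a * h a"
  by (simp add: generator_def out_rate_eq_sum right_diff_distrib sum_subtractf sum_distrib_right)

lemma generator_add: "generator Q (\<lambda>a. f a + g a) a = generator Q f a + generator Q g a"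
  by (simp add: generator_def sum.distrib[symmetric] algebra_simps)

lemma generator_cmult: "generator Q (\<lambda>a. c * f a) a = c * generator Q f a"
  by (simp add: generator_def sum_distrib_left algebra_simps)

lemma jump_prob_eq: "jump_prob Q a b = Q a b / out_rate Q a"
  by (simp add: jump_prob_def rate_diag)

lemma jump_prob_nonneg: "jump_prob Q a b \<ge> 0"
  using rate_nonneg[of a b] out_rate_pos[of a] by (simp add: jump_prob_eq)

lemma sum_jump_prob: "(\<Sum>b | Q a b \<noteq> 0. jump_prob Q a b) = 1"
  using out_rate_pos[of a] by (simp add: jump_prob_eq out_rate_eq_sum sum_divide_distrib[symmetric])

lemma sum_jump_prob_mult:
  "(\<Sum>b | Q a b \<noteq> 0. jump_prob Q a b * h b) = h a + generator Q h a / out_rate Q a"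
  using out_rate_pos[of a] 
  by (simp add: jump_prob_eq generator_eq sum_divide_distrib[symmetric] field_simps)

lemma path_prob_nonneg: "path_prob Q zs \<ge> 0"
  unfolding path_prob_def by (intro prod_nonneg ballI jump_prob_nonneg)

lemma path_prob_has_sum: "(path_prob Q has_sum first_hit_prob Q s n a) (paths_to s n a)"
proof (induction n arbitrary: a)
  case 0
  show ?case unfolding paths_to_0 by (rule has_sum_finiteI) (auto simp: path_prob_def)
next
  case (Suc n)
  show ?case unfolding paths_to_Suc
  proof (rule has_sum_disjoint_UN_nonneg)
    fix b
    have "((\<lambda>zs. jump_prob Q a b * path_prob Q zs) has_sum
        jump_prob Q a b * first_hit_prob Q s n b) (paths_to s n b)"
      by (intro has_sum_cmult_right Suc)
    then have "((path_prob Q \<circ> (#) a) has_sum jump_prob Q a b * first_hit_prob Q s n b)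
        (paths_to s n b)"
      by (rule has_sum_cong[THEN iffD1, rotated])
         (auto simp: paths_to_def intro!: path_prob_Cons[symmetric, THEN trans[rotated]])
    then show "(path_prob Q has_sum jump_prob Q a b * first_hit_prob Q s n b)
        ((#) a ` paths_to s n b)"
      by (subst has_sum_reindex) auto
  next
    show "((\<lambda>b. jump_prob Q a b * first_hit_prob Q s n b) has_sum
        first_hit_prob Q s (Suc n) a) (- {s})"
      by (rule has_sum_finite_neutralI[where B = "{b. Q a b \<noteq> 0} - {s}"])
         (auto simp: finite_succ jump_prob_eq)
  next
    show "disjoint_family_on (\<lambda>b. (#) a ` paths_to s n b) (- {s})"
      by (auto simp: disjoint_family_on_def paths_to_def)
  qed (rule path_prob_nonneg)
qed

lemma avoid_prob_nonneg: "avoid_prob Q s n a \<ge> 0"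
  by (induction n arbitrary: a) (auto intro!: sum_nonneg mult_nonneg_nonneg jump_prob_nonneg)

lemma first_hit_prob_nonneg: "first_hit_prob Q s n a \<ge> 0"
  by (rule has_sum_nonneg[OF path_prob_has_sum path_prob_nonneg])

lemma first_hit_prob_eq_diff: "first_hit_prob Q s n a = avoid_prob Q s n a - avoid_prob Q s (Suc n) a"
proof (induction n arbitrary: a)
  case 0
  have "(\<Sum>b | Q a b \<noteq> 0. jump_prob Q a b) =
      (\<Sum>b\<in>{b. Q a b \<noteq> 0} - {s}. jump_prob Q a b) + jump_prob Q a s"
    using finite_succ[of a] 
    by (cases "Q a s = 0") (auto simp: sum.remove[of _ s] jump_prob_eq)
  then show ?case by (simp add: sum_jump_prob)
next
  case (Suc n)
  have "first_hit_prob Q s (Suc n) a = (\<Sum>b\<in>{b. Q a b \<noteq> 0} - {s}.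
      jump_prob Q a b * avoid_prob Q s n b - jump_prob Q a b * avoid_prob Q s (Suc n) b)"
    unfolding first_hit_prob.simps Suc by (simp only: right_diff_distrib)
  then show ?case by (simp only: sum_subtractf avoid_prob.simps)
qed

lemma sum_avoid_prob_Suc:
  "(\<Sum>k<Suc n. avoid_prob Q s k a) =
     1 + (\<Sum>b\<in>{b. Q a b \<noteq> 0} - {s}. jump_prob Q a b * (\<Sum>k<n. avoid_prob Q s k b))"
  unfolding sum.lessThan_Suc_shift
  by (simp add: sum_distrib_left) (rule sum.swap)

lemma sum_avoid_prob_le_step:
  assumes V: "\<And>a. V a \<ge> 0"
    and IH: "\<And>b. b \<noteq> s \<Longrightarrow> (\<Sum>k<n. avoid_prob Q s k b) \<le> V b"
  shows "(\<Sum>k<Suc n. avoid_prob Q s k a) \<le> 1 + V a + generator Q V a / out_rate Q a"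
proof -
  have "(\<Sum>b\<in>{b. Q a b \<noteq> 0} - {s}. jump_prob Q a b * (\<Sum>k<n. avoid_prob Q s k b))
      \<le> (\<Sum>b\<in>{b. Q a b \<noteq> 0} - {s}. jump_prob Q a b * V b)"
    by (intro sum_mono mult_left_mono IH jump_prob_nonneg) auto
  also have "\<dots> \<le> (\<Sum>b | Q a b \<noteq> 0. jump_prob Q a b * V b)"
    by (intro sum_mono2 finite_succ mult_nonneg_nonneg jump_prob_nonneg V) auto
  finally show ?thesis unfolding sum_avoid_prob_Suc sum_jump_prob_mult by simp
qed

lemma sum_avoid_prob_le:
  assumes V: "\<And>a. V a \<ge> 0" and drift: "\<And>a. a \<noteq> s \<Longrightarrow> generator Q V a \<le> - out_rate Q a"
    and "a \<noteq> s"
  shows "(\<Sum>k<n. avoid_prob Q s k a) \<le> V a"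
  using \<open>a \<noteq> s\<close>
proof (induction n arbitrary: a)
  case (Suc n)
  have "generator Q V a / out_rate Q a \<le> -1"
    using drift[OF Suc.prems] out_rate_pos[of a] by (simp add: field_simps)
  with sum_avoid_prob_le_step[of V s n a, OF V Suc.IH] show ?case by linarith
qed (use V in auto)

lemma pos_recurrent_state_if_drift:
  assumes V: "\<And>a. V a \<ge> 0" and drift: "\<And>a. a \<noteq> s \<Longrightarrow> generator Q V a \<le> - out_rate Q a"
    and q: "q > 0" "\<And>a. out_rate Q a \<ge> q"
  shows "pos_recurrent_state Q s"
proof -
  define f where "f = (\<lambda>n. first_hit_prob Q s n s)"
  define g where "g = (\<lambda>n. avoid_prob Q s n s)"
  define C where "C = 1 + V s + \<bar>generator Q V s / out_rate Q s\<bar>"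
  have f_nonneg: "f n \<ge> 0" for n unfolding f_def by (rule first_hit_prob_nonneg)
  have g_nonneg: "g n \<ge> 0" for n unfolding g_def by (rule avoid_prob_nonneg)
  have f_eq: "f n = g n - g (Suc n)" for n unfolding f_def g_def by (rule first_hit_prob_eq_diff)
  have g_le: "(\<Sum>k<n. g k) \<le> C" for n
  proof (cases n)
    case 0 then show ?thesis using V[of s] by (simp add: C_def)
  next
    case (Suc m)
    show ?thesis using sum_avoid_prob_le_step[of V s m s, OF V sum_avoid_prob_le[of V s, OF V drift]]
      unfolding Suc g_def C_def by linarith
  qed
  have "summable g" by (rule summableI_nonneg_bounded[OF g_nonneg g_le])
  then have g_lim: "g \<longlonglongrightarrow> 0" by (rule summable_LIMSEQ_zero)
  have "f sums (g 0 - 0)" unfolding f_eq[abs_def] by (rule telescope_sums'[OF g_lim])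
  then have f_sum: "(f has_sum 1) UNIV"
    using f_nonneg by (intro sums_nonneg_imp_has_sum) (auto simp: g_def)
  have "(\<Sum>k<n. real (Suc k) * f k) = (\<Sum>k<n. g k) - real n * g n" for n
    by (induction n) (auto simp: f_eq algebra_simps)
  then have "(\<Sum>k<n. real (Suc k) * f k) \<le> C" for n
    using g_le[of n] g_nonneg[of n] by (smt (verit) mult_nonneg_nonneg of_nat_0_le_iff)
  then have "summable (\<lambda>k. real (Suc k) * f k)"
    using f_nonneg by (intro summableI_nonneg_bounded) auto
  then have kf_sum: "(\<lambda>k. real (Suc k) * f k) summable_on UNIV"
    using f_nonneg by (intro summable_nonneg_imp_summable_on) auto
  have disj: "disjoint_family (\<lambda>n. paths_to s n s)"
    by (auto simp: disjoint_family_on_def paths_to_def)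
  have path_sum: "(path_prob Q has_sum f n) (paths_to s n s)" for n
    unfolding f_def by (rule path_prob_has_sum)
  have "(path_prob Q has_sum 1) (excursions s)"
    unfolding excursions_eq_UN_paths_to
    by (rule has_sum_disjoint_UN_nonneg[OF path_sum f_sum path_prob_nonneg disj])
  then have ret: "return_prob Q s = 1"
    unfolding return_prob_def
    by (subst infsum_ennreal) (auto simp: has_sum_imp_summable infsumI path_prob_nonneg)
  have "((\<lambda>zs. real (length zs - 1) * path_prob Q zs) has_sum real (Suc n) * f n) (paths_to s n s)" for n
    by (rule has_sum_cong[THEN iffD1, OF _ has_sum_cmult_right[OF path_sum]])
       (auto simp: paths_to_def)
  then have len_sum: "(\<lambda>zs. real (length zs - 1) * path_prob Q zs) summable_on excursions s"
    unfolding excursions_eq_UN_paths_to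
    by (rule summable_on_UnionI[OF _ kf_sum _ disj]) (auto intro!: mult_nonneg_nonneg path_prob_nonneg)
  have hold: "0 \<le> holding_time Q zs" "holding_time Q zs \<le> real (length zs - 1) / q" for zs
  proof -
    show "0 \<le> holding_time Q zs" unfolding holding_time_def
      by (intro sum_nonneg) (auto intro: less_imp_le[OF out_rate_pos])
    have "holding_time Q zs \<le> (\<Sum>i<length zs - 1. 1 / q)" unfolding holding_time_def
      by (intro sum_mono divide_left_mono q mult_pos_pos out_rate_pos) auto
    then show "holding_time Q zs \<le> real (length zs - 1) / q" by simp
  qed
  have "(\<lambda>zs. path_prob Q zs * holding_time Q zs) summable_on excursions s"
  proof (rule summable_on_comparison_test)
    show "(\<lambda>zs. real (length zs - 1) * path_prob Q zs * (1 / q)) summable_on excursions s"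
      by (rule summable_on_cmult_left[OF len_sum])
    show "path_prob Q zs * holding_time Q zs \<le> real (length zs - 1) * path_prob Q zs * (1 / q)" for zs
      using mult_left_mono[OF hold(2) path_prob_nonneg, of zs zs] by (simp add: mult_ac)
  qed (auto intro!: mult_nonneg_nonneg path_prob_nonneg hold)
  then have "mean_return_time Q s < \<infinity>"
    unfolding mean_return_time_def
    by (subst infsum_ennreal) (auto intro!: mult_nonneg_nonneg path_prob_nonneg hold)
  with ret show ?thesis by (simp add: pos_recurrent_state_def)
qed

primrec reach_ball :: "'s \<Rightarrow> nat \<Rightarrow> 's set" where
  "reach_ball s 0 = {s}"
| "reach_ball s (Suc n) = reach_ball s n \<union> (\<Union>b\<in>reach_ball s n. {a. Q a b \<noteq> 0})"

lemma finite_within: "finite (reach_ball s n)"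
  by (induction n) (auto simp: finite_pred)

lemma within_mono: "m \<le> n \<Longrightarrow> reach_ball s m \<subseteq> reach_ball s n"
  by (induction n) (auto simp: le_Suc_eq)

lemma reachable_imp_within: "reachable Q a s \<Longrightarrow> \<exists>n. a \<in> reach_ball s n"
  unfolding reachable_def
proof (induction rule: converse_rtranclp_induct)
  case base
  have "s \<in> reach_ball s 0" by simp
  then show ?case by blast
next
  case (step a b)
  then obtain n where "b \<in> reach_ball s n" by auto
  with step have "a \<in> reach_ball s (Suc n)" by auto
  then show ?case by blast
qed

text \<open>Adding a small multiple of the indicator of the complement of \<open>reach_ball s n\<close> makes the drift
  strictly negative one step further out, at the price of a bounded perturbation on the finite set
  where it is strictly negative already.\<close>

lemma ex_strict_supersolution:
  "\<exists>W. (\<forall>a. W a \<ge> 0) \<and> (\<forall>a. a \<noteq> s \<longrightarrow> generator Q W a \<le> 0) \<and>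
       (\<forall>a\<in>reach_ball s n - {s}. generator Q W a < 0)"
proof (induction n)
  case 0
  show ?case by (rule exI[of _ "\<lambda>_. 0"]) (auto simp: generator_def)
next
  case (Suc n)
  then obtain W where W: "\<And>a. W a \<ge> 0" "\<And>a. a \<noteq> s \<Longrightarrow> generator Q W a \<le> 0"
    "\<And>a. a \<in> reach_ball s n \<Longrightarrow> a \<noteq> s \<Longrightarrow> generator Q W a < 0" by blast
  define I :: "'s \<Rightarrow> real" where "I = (\<lambda>a. if a \<in> reach_ball s n then 0 else 1)"
  have I_out: "generator Q I a \<le> 0" if "a \<notin> reach_ball s n" for a
    unfolding generator_def I_def using that
    by (intro sum_nonpos mult_nonneg_nonpos rate_nonneg) auto
  have I_next: "generator Q I a < 0" if a: "a \<notin> reach_ball s n" and "a \<in> reach_ball s (Suc n)" for a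
  proof -
    from that obtain b where b: "b \<in> reach_ball s n" "Q a b \<noteq> 0" by auto
    have "generator Q I a \<le> (\<Sum>c\<in>{b}. Q a c * (I c - I a))"
      unfolding generator_def
      by (subst sum.subset_diff[of "{b}", OF _ finite_succ])
         (use a b in \<open>auto simp: I_def intro!: sum_nonpos mult_nonneg_nonpos rate_nonneg\<close>)
    also have "\<dots> < 0" using a b rate_nonneg[of a b] by (auto simp: I_def)
    finally show ?thesis .
  qed
  have "\<forall>\<^sub>F \<rho> in at_right 0. \<forall>a\<in>reach_ball s n - {s}. generator Q W a + \<rho> * generator Q I a < 0"
  proof (rule eventually_ball_finite, simp add: finite_within, rule ballI)
    fix a assume a: "a \<in> reach_ball s n - {s}"
    have "((\<lambda>\<rho>. generator Q W a + \<rho> * generator Q I a) \<longlongrightarrow> generator Q W a + 0 * generator Q I a) (at_right 0)"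
      by (intro tendsto_intros)
    then show "\<forall>\<^sub>F \<rho> in at_right 0. generator Q W a + \<rho> * generator Q I a < 0"
      by (rule order_tendstoD) (use W a in auto)
  qed
  then have "\<forall>\<^sub>F \<rho> in at_right 0. \<rho> > 0 \<and> (\<forall>a\<in>reach_ball s n - {s}. generator Q W a + \<rho> * generator Q I a < 0)"
    by (intro eventually_conj eventually_at_right_less)
  then obtain \<rho> :: real where \<rho>: "\<rho> > 0"
      "\<And>a. a \<in> reach_ball s n \<Longrightarrow> a \<noteq> s \<Longrightarrow> generator Q W a + \<rho> * generator Q I a < 0"
    using eventually_happens'[OF trivial_limit_at_right_real] by blast
  have eq: "generator Q (\<lambda>a. W a + \<rho> * I a) a = generator Q W a + \<rho> * generator Q I a" for a
    by (simp add: generator_add generator_cmult)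
  show ?case
  proof (intro exI[of _ "\<lambda>a. W a + \<rho> * I a"] conjI allI impI ballI)
    show "W a + \<rho> * I a \<ge> 0" for a using W \<rho> by (auto simp: I_def)
    show "generator Q (\<lambda>a. W a + \<rho> * I a) a \<le> 0" if "a \<noteq> s" for a
      unfolding eq using that \<rho> W(2)[of a] I_out[of a]
      by (cases "a \<in> reach_ball s n") (auto intro: less_imp_le add_nonpos_nonpos mult_nonneg_nonpos)
    show "generator Q (\<lambda>a. W a + \<rho> * I a) a < 0" if "a \<in> reach_ball s (Suc n) - {s}" for a
      unfolding eq using that \<rho> W(2)[of a] I_next[of a]
      by (cases "a \<in> reach_ball s n") (auto intro: add_nonpos_neg mult_pos_neg)
  qed
qed

theorem foster_criterion:
  assumes V: "\<And>a. V a \<ge> 0" and F: "finite F"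
    and drift: "\<And>a. a \<notin> F \<Longrightarrow> generator Q V a \<le> - out_rate Q a"
    and reach: "\<And>a. reachable Q a s"
    and q: "q > 0" "\<And>a. out_rate Q a \<ge> q"
  shows "pos_recurrent Q"
proof -
  obtain d where d: "\<And>a. a \<in> reach_ball s (d a)" using reachable_imp_within[OF reach] by metis
  define n where "n = Max (insert 0 (d ` F))"
  have "F \<subseteq> reach_ball s n"
  proof
    fix a assume "a \<in> F"
    then have "d a \<le> n" unfolding n_def using F by (intro Max_ge) auto
    with d within_mono show "a \<in> reach_ball s n" by blast
  qed
  with ex_strict_supersolution[of s n] obtain W where W: "\<And>a. W a \<ge> 0" "\<And>a. a \<noteq> s \<Longrightarrow> generator Q W a \<le> 0"
    "\<And>a. a \<in> F \<Longrightarrow> a \<noteq> s \<Longrightarrow> generator Q W a < 0" by blast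
  have "\<forall>\<^sub>F K in at_top. \<forall>a\<in>F - {s}. generator Q V a + K * generator Q W a \<le> - out_rate Q a"
  proof (rule eventually_ball_finite, simp add: F, rule ballI)
    fix a assume "a \<in> F - {s}"
    then have neg: "generator Q W a < 0" using W by auto
    show "\<forall>\<^sub>F K in at_top. generator Q V a + K * generator Q W a \<le> - out_rate Q a"
      using eventually_ge_at_top[of "(generator Q V a + out_rate Q a) / - generator Q W a"]
    proof eventually_elim
      case (elim K)
      then show ?case using neg by (simp add: field_simps)
    qed
  qed
  then have "\<forall>\<^sub>F K in at_top. K \<ge> 0 \<and> (\<forall>a\<in>F - {s}. generator Q V a + K * generator Q W a \<le> - out_rate Q a)"
    by (intro eventually_conj eventually_ge_at_top)
  then obtain K :: real where K: "K \<ge> 0"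
    "\<And>a. a \<in> F \<Longrightarrow> a \<noteq> s \<Longrightarrow> generator Q V a + K * generator Q W a \<le> - out_rate Q a"
    using eventually_happens'[OF trivial_limit_at_top_linorder] by blast
  have "pos_recurrent_state Q s"
  proof (rule pos_recurrent_state_if_drift[where V = "\<lambda>a. V a + K * W a"])
    show "V a + K * W a \<ge> 0" for a using V W K by auto
    show "generator Q (\<lambda>a. V a + K * W a) a \<le> - out_rate Q a" if "a \<noteq> s" for a
    proof (cases "a \<in> F")
      case True then show ?thesis using K that by (simp add: generator_add generator_cmult)
    next
      case False
      have "K * generator Q W a \<le> 0" using K W that by (intro mult_nonneg_nonpos) auto
      with drift[OF False] show ?thesis by (simp add: generator_add generator_cmult)
    qed
  qed (fact q)+
  with reach show ?thesis by (auto simp: pos_recurrent_def)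
qed

lemma stationary_generator_sum:
  assumes \<pi>: "stationary_dist Q \<pi>" and J: "finite J" "\<And>a. a \<notin> J \<Longrightarrow> h a = 0"
    and S: "finite S" "J \<subseteq> S" "\<And>a b. b \<in> J \<Longrightarrow> Q a b \<noteq> 0 \<Longrightarrow> a \<in> S"
  shows "(\<Sum>a\<in>S. \<pi> a * generator Q h a) = 0"
proof -
  have bal: "(\<Sum>a\<in>S. \<pi> a * Q a b) = \<pi> b * out_rate Q b" if "b \<in> J" for b
  proof -
    have "((\<lambda>a. \<pi> a * Q a b) has_sum \<pi> b * out_rate Q b) (- {b})"
      using \<pi> by (auto simp: stationary_dist_def)
    moreover have "((\<lambda>a. \<pi> a * Q a b) has_sum (\<Sum>a\<in>S - {b}. \<pi> a * Q a b)) (- {b})"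
      by (rule has_sum_finite_neutralI[where B = "S - {b}"]) (use S that in auto)
    ultimately have "\<pi> b * out_rate Q b = (\<Sum>a\<in>S - {b}. \<pi> a * Q a b)"
      by (rule has_sum_unique)
    also have "\<dots> = (\<Sum>a\<in>S. \<pi> a * Q a b)"
      using S by (intro sum.mono_neutral_left) (auto simp: rate_diag)
    finally show ?thesis by simp
  qed
  have gen: "generator Q h a = (\<Sum>b\<in>J. Q a b * h b) - out_rate Q a * h a" for a
  proof -
    have "(\<Sum>b | Q a b \<noteq> 0. Q a b * h b) = (\<Sum>b\<in>{b. Q a b \<noteq> 0} \<union> J. Q a b * h b)"
      using J finite_succ by (intro sum_rates_superset) auto
    also have "\<dots> = (\<Sum>b\<in>J. Q a b * h b)"
      using J finite_succ by (intro sum.mono_neutral_right) auto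
    finally show ?thesis by (simp add: generator_eq)
  qed
  have "(\<Sum>a\<in>S. \<pi> a * generator Q h a) =
      (\<Sum>a\<in>S. \<Sum>b\<in>J. \<pi> a * Q a b * h b) - (\<Sum>a\<in>S. \<pi> a * out_rate Q a * h a)"
    by (simp add: gen right_diff_distrib sum_subtractf sum_distrib_left mult_ac)
  also have "(\<Sum>a\<in>S. \<Sum>b\<in>J. \<pi> a * Q a b * h b) = (\<Sum>b\<in>J. \<pi> b * out_rate Q b * h b)"
    by (subst sum.swap) (simp add: bal sum_distrib_right[symmetric])
  also have "(\<Sum>a\<in>S. \<pi> a * out_rate Q a * h a) = (\<Sum>b\<in>J. \<pi> b * out_rate Q b * h b)"
    using S J by (intro sum.mono_neutral_right) auto
  finally show ?thesis by simp
qed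

text \<open>No integrability of \<open>V\<close> is needed: the balance equations are tested against
  \<open>max 0 (c - V)\<close>, which has finite support.\<close>

lemma stationary_drift_bound:
  assumes \<pi>: "stationary_dist Q \<pi>"
    and levels: "\<And>c. finite {a. V a < c}"
    and g: "\<And>a. g a \<ge> 0" and drift: "\<And>a. generator Q V a \<le> B - g a" and B: "B \<ge> 0"
  shows "(\<lambda>a. \<pi> a * g a) summable_on UNIV" and "(\<Sum>\<^sub>\<infinity>a. \<pi> a * g a) \<le> B"
proof -
  have \<pi>_nonneg: "\<pi> a \<ge> 0" for a using \<pi> by (auto simp: stationary_dist_def)
  have \<pi>_sum: "sum \<pi> A \<le> 1" if "finite A" for A
    using \<pi> that by (intro finite_sum_le_has_sum[where A = UNIV]) (auto simp: stationary_dist_def)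
  have fin: "(\<Sum>a\<in>A. \<pi> a * g a) \<le> B" if A: "finite A" for A
  proof -
    define c where "c = Max (insert 0 (V ` A)) + 1"
    have A_less: "V a < c" if "a \<in> A" for a
    proof -
      have "V a \<le> Max (insert 0 (V ` A))" using A that by (intro Max_ge) auto
      then show ?thesis by (simp add: c_def)
    qed
    define J where "J = {a. V a < c}"
    define h where "h = (\<lambda>a. max 0 (c - V a))"
    define S where "S = J \<union> (\<Union>b\<in>J. {a. Q a b \<noteq> 0})"
    have J: "finite J" unfolding J_def by (rule levels)
    have S: "finite S" unfolding S_def using J finite_pred by auto
    have gen_in: "generator Q h a \<ge> - generator Q V a" if "a \<in> J" for a
      unfolding generator_def sum_negf[symmetric]
    proof (rule sum_mono)
      fix b
      have "- (V b - V a) \<le> h b - h a" using that by (auto simp: h_def J_def)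
      then show "- (Q a b * (V b - V a)) \<le> Q a b * (h b - h a)"
        using mult_left_mono[OF _ rate_nonneg, of "- (V b - V a)" "h b - h a" a b]
        by (simp add: algebra_simps)
    qed
    have gen_out: "generator Q h a \<ge> 0" if "a \<notin> J" for a
      unfolding generator_def using that
      by (intro sum_nonneg mult_nonneg_nonneg rate_nonneg) (auto simp: h_def J_def)
    have "0 = (\<Sum>a\<in>S. \<pi> a * generator Q h a)"
      using stationary_generator_sum[OF \<pi> J, of h S] S by (auto simp: S_def h_def J_def)
    also have "\<dots> \<ge> (\<Sum>a\<in>J. \<pi> a * generator Q h a)"
      using S gen_out \<pi>_nonneg by (intro sum_mono2) (auto simp: S_def)
    finally have "(\<Sum>a\<in>J. \<pi> a * generator Q h a) \<le> 0" .
    moreover have "(\<Sum>a\<in>J. \<pi> a * (g a - B)) \<le> (\<Sum>a\<in>J. \<pi> a * generator Q h a)"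
    proof (intro sum_mono mult_left_mono \<pi>_nonneg)
      fix a assume "a \<in> J"
      with gen_in[of a] drift[of a] show "g a - B \<le> generator Q h a" by linarith
    qed
    ultimately have "(\<Sum>a\<in>J. \<pi> a * g a) \<le> B * (\<Sum>a\<in>J. \<pi> a)"
      by (simp add: right_diff_distrib sum_subtractf sum_distrib_left mult_ac)
    also have "\<dots> \<le> B" using mult_left_mono[OF \<pi>_sum[OF J] B] by simp
    finally have "(\<Sum>a\<in>J. \<pi> a * g a) \<le> B" .
    moreover have "(\<Sum>a\<in>A. \<pi> a * g a) \<le> (\<Sum>a\<in>J. \<pi> a * g a)"
      using J A_less \<pi>_nonneg g by (intro sum_mono2) (auto simp: J_def)
    ultimately show ?thesis by linarith
  qed
  show summable: "(\<lambda>a. \<pi> a * g a) summable_on UNIV"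
    using \<pi>_nonneg g fin by (intro nonneg_bdd_above_summable_on bdd_aboveI2[where M = B]) auto
  show "(\<Sum>\<^sub>\<infinity>a. \<pi> a * g a) \<le> B"
    by (rule infsum_le_finite_sums[OF summable fin])
qed

end

lemma finite_lattice_box:
  "finite {(y :: int, x :: nat). (real_of_int y)\<^sup>2 \<le> K \<and> (real x - m)\<^sup>2 \<le> K}" (is "finite ?A")
proof -
  define N where "N = \<lceil>sqrt K + \<bar>m\<bar>\<rceil>"
  have "?A \<subseteq> {-N..N} \<times> {..nat N}"
  proof
    fix s assume "s \<in> ?A"
    then obtain y x where s: "s = (y, x)" and
      "(real_of_int y)\<^sup>2 \<le> K" "(real x - m)\<^sup>2 \<le> K" by auto
    then have "\<bar>real_of_int y\<bar> \<le> sqrt K" "\<bar>real x - m\<bar> \<le> sqrt K"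
      by (metis real_sqrt_abs real_sqrt_le_iff)+
    then have "real_of_int \<bar>y\<bar> \<le> N" "real x \<le> N"
      unfolding N_def by linarith+
    then show "s \<in> {-N..N} \<times> {..nat N}" by (auto simp: s)
  qed
  then show ?thesis by (rule finite_subset) auto
qed

lemma linear_le_square:
  fixes \<alpha> d t :: real
  assumes "\<alpha> > 0"
  shows "d * \<bar>t\<bar> \<le> \<alpha> * t\<^sup>2 + d\<^sup>2 / (4 * \<alpha>)"
proof -
  have "0 \<le> (2 * \<alpha> * \<bar>t\<bar> - d)\<^sup>2 / (4 * \<alpha>)" using assms by simp
  also have "\<dots> = \<alpha> * t\<^sup>2 + d\<^sup>2 / (4 * \<alpha>) - d * \<bar>t\<bar>"
    using assms by (simp add: power2_eq_square field_simps)
  finally show ?thesis by simp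
qed

lemma expectation_deviation_bound:
  fixes \<phi> :: "'s \<Rightarrow> 'b::real_normed_vector" and f :: "'b \<Rightarrow> real"
  assumes \<pi>: "\<And>s. \<pi> s \<ge> 0" "(\<pi> has_sum 1) UNIV"
    and \<phi>: "(\<lambda>s. \<pi> s * min ((norm (\<phi> s))\<^sup>2) 1) summable_on UNIV"
      "(\<Sum>\<^sub>\<infinity>s. \<pi> s * min ((norm (\<phi> s))\<^sup>2) 1) \<le> b"
    and f: "\<And>p. \<bar>f p\<bar> \<le> M" "\<And>p. norm p < \<delta> \<Longrightarrow> \<bar>f p - f 0\<bar> \<le> e"
    and pos: "\<delta> > 0" "e \<ge> 0"
  shows "\<bar>(\<Sum>\<^sub>\<infinity>s. \<pi> s * f (\<phi> s)) - f 0\<bar> \<le> e + 2 * M / min (\<delta>\<^sup>2) 1 * b"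
proof -
  define G where "G = (\<lambda>s. min ((norm (\<phi> s))\<^sup>2) 1)"
  define \<eta> where "\<eta> = min (\<delta>\<^sup>2) 1"
  have \<eta>: "\<eta> > 0" using pos by (simp add: \<eta>_def)
  have M: "M \<ge> 0" using f(1)[of 0] by linarith
  have dev: "\<bar>f (\<phi> s) - f 0\<bar> \<le> e + 2 * M / \<eta> * G s" for s
  proof (cases "norm (\<phi> s) < \<delta>")
    case True
    have "0 \<le> 2 * M / \<eta> * G s" using M \<eta> by (simp add: G_def)
    with f(2)[OF True] show ?thesis by linarith
  next
    case False
    then have "\<delta>\<^sup>2 \<le> (norm (\<phi> s))\<^sup>2" using pos by (intro power_mono) auto
    then have "\<eta> \<le> G s" by (auto simp: \<eta>_def G_def)
    then have "2 * M * 1 \<le> 2 * M * (G s / \<eta>)" using M \<eta> by (intro mult_left_mono) auto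
    then have "2 * M \<le> 2 * M / \<eta> * G s" by simp
    with f(1)[of "\<phi> s"] f(1)[of 0] pos show ?thesis by linarith
  qed
  have \<pi>_summable: "\<pi> summable_on UNIV" using \<pi>(2) by (rule has_sum_imp_summable)
  have bound_sum: "((\<lambda>s. \<pi> s * e + \<pi> s * G s * (2 * M / \<eta>)) has_sum
      1 * e + (\<Sum>\<^sub>\<infinity>s. \<pi> s * G s) * (2 * M / \<eta>)) UNIV"
    by (intro has_sum_add has_sum_cmult_left \<pi>(2) has_sum_infsum) (use \<phi> in \<open>auto simp: G_def\<close>)
  have dev': "\<pi> s * \<bar>f (\<phi> s) - f 0\<bar> \<le> \<pi> s * e + \<pi> s * G s * (2 * M / \<eta>)" for s
    using mult_left_mono[OF dev \<pi>(1), of s s] by (simp add: algebra_simps)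
  have abs_sum: "(\<lambda>s. norm (\<pi> s * (f (\<phi> s) - f 0))) summable_on UNIV"
    by (rule summable_on_comparison_test[OF has_sum_imp_summable[OF bound_sum]])
       (use dev' \<pi>(1) in \<open>auto simp: abs_mult\<close>)
  have "(\<lambda>s. \<pi> s * (f (\<phi> s) - f 0) + \<pi> s * f 0) summable_on UNIV"
    by (rule summable_on_add[OF abs_summable_summable[OF abs_sum] summable_on_cmult_left[OF \<pi>_summable]])
  then have f_summable: "(\<lambda>s. \<pi> s * f (\<phi> s)) summable_on UNIV"
    by (simp add: algebra_simps)
  have "((\<lambda>s. \<pi> s * f (\<phi> s) + \<pi> s * - f 0) has_sum (\<Sum>\<^sub>\<infinity>s. \<pi> s * f (\<phi> s)) + 1 * - f 0) UNIV"
    by (intro has_sum_add has_sum_infsum f_summable has_sum_cmult_left \<pi>(2))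
  then have "(\<Sum>\<^sub>\<infinity>s. \<pi> s * f (\<phi> s)) - f 0 = (\<Sum>\<^sub>\<infinity>s. \<pi> s * (f (\<phi> s) - f 0))"
    by (simp add: infsumI right_diff_distrib)
  also have "\<bar>\<dots>\<bar> \<le> (\<Sum>\<^sub>\<infinity>s. norm (\<pi> s * (f (\<phi> s) - f 0)))"
    using norm_infsum_bound[OF abs_sum] by simp
  also have "\<dots> \<le> e + (\<Sum>\<^sub>\<infinity>s. \<pi> s * G s) * (2 * M / \<eta>)"
    using has_sum_mono[OF has_sum_infsum[OF abs_sum] bound_sum] dev' \<pi>(1) by (auto simp: abs_mult)
  also have "\<dots> \<le> e + b * (2 * M / \<eta>)"
    using \<phi>(2) M \<eta> by (intro add_left_mono mult_right_mono) (auto simp: G_def)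
  finally show ?thesis by (simp add: \<eta>_def mult.commute)
qed

section \<open>The feedback model\<close>

lemma reachable_trans: "reachable q a b \<Longrightarrow> reachable q b c \<Longrightarrow> reachable q a c"
  unfolding reachable_def by (rule rtranclp_trans)

lemma reachable_step: "a \<noteq> b \<Longrightarrow> q a b > 0 \<Longrightarrow> reachable q b c \<Longrightarrow> reachable q a c"
  unfolding reachable_def by (rule converse_rtranclp_into_rtranclp) auto

locale feedback_model =
  fixes lam bet eps :: real and gam :: nat
  assumes lam: "lam > 0" and bet: "bet > 0" and eps: "eps > 0" and gam: "gam > 0"
begin

abbreviation Q :: "real \<Rightarrow> int \<times> nat \<Rightarrow> int \<times> nat \<Rightarrow> real" where
  "Q \<equiv> model_rate lam bet eps gam"

definition control_rate :: "int \<Rightarrow> nat \<Rightarrow> real" where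
  "control_rate y x = (if x \<ge> 1 \<or> y < 0 then eps * real_of_int \<bar>y\<bar> else 0)"

lemma Q_eq:
  "Q r (y, x) s = (if s = (y - 1, x + gam) then lam * r else 0)
     + (if s = (y + 1, x - min gam x) then bet * real x else 0)
     + (if s = (y, nat (int x - sgn y)) then control_rate y x else 0)"
  by (auto simp: model_rate_def control_rate_def)

lemma sum_Q:
  "(\<Sum>s | Q r (y, x) s \<noteq> 0. Q r (y, x) s * h s) = lam * r * h (y - 1, x + gam)
     + bet * real x * h (y + 1, x - min gam x)
     + control_rate y x * h (y, nat (int x - sgn y))"
proof -
  define T where "T = {(y - 1, x + gam), (y + 1, x - min gam x), (y, nat (int x - sgn y))}"
  have T: "finite T" "(y - 1, x + gam) \<in> T" "(y + 1, x - min gam x) \<in> T"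
    "(y, nat (int x - sgn y)) \<in> T" by (auto simp: T_def)
  have "(\<Sum>s | Q r (y, x) s \<noteq> 0. Q r (y, x) s * h s) = (\<Sum>s\<in>T. Q r (y, x) s * h s)"
    by (intro sum.mono_neutral_left) (auto simp: T_def Q_eq split: if_splits)
  also have "\<dots> = (\<Sum>s\<in>T. (if s = (y - 1, x + gam) then lam * r * h s else 0)
     + (if s = (y + 1, x - min gam x) then bet * real x * h s else 0)
     + (if s = (y, nat (int x - sgn y)) then control_rate y x * h s else 0))"
    by (intro sum.cong refl) (auto simp: Q_eq)
  also have "\<dots> = lam * r * h (y - 1, x + gam)
     + bet * real x * h (y + 1, x - min gam x)
     + control_rate y x * h (y, nat (int x - sgn y))"
    using T by (simp add: sum.distrib)
  finally show ?thesis .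
qed

lemma Q_diag: "Q r s s = 0"
  by (cases s) (auto simp: Q_eq control_rate_def sgn_if)

lemma finite_Q_succ: "finite {s'. Q r s s' \<noteq> 0}"
proof -
  obtain y x where s: "s = (y, x)" by (cases s)
  have "{s'. Q r s s' \<noteq> 0} \<subseteq> {(y - 1, x + gam), (y + 1, x - min gam x), (y, nat (int x - sgn y))}"
    by (auto simp: s Q_eq split: if_splits)
  then show ?thesis by (rule finite_subset) auto
qed

lemma finite_Q_pred: "finite {s. Q r s s' \<noteq> 0}"
proof (rule finite_subset)
  obtain y' x' where s': "s' = (y', x')" by (cases s')
  show "{s. Q r s s' \<noteq> 0} \<subseteq> {fst s' - 1..fst s' + 1} \<times> {..snd s' + gam + 1}"
    by (auto simp: s' Q_eq sgn_if split: if_splits)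
qed auto

lemma out_rate_Q: "out_rate (Q r) (y, x) = lam * r + bet * real x + control_rate y x"
proof -
  have "out_rate (Q r) (y, x) = (\<Sum>s | Q r (y, x) s \<noteq> 0. Q r (y, x) s * 1)"
    unfolding out_rate_def
    by (intro infsumI has_sum_finite_neutralI[OF finite_Q_succ]) (use Q_diag in auto)
  then show ?thesis unfolding sum_Q by simp
qed

lemma control_rate_nonneg: "control_rate y x \<ge> 0"
  using eps by (simp add: control_rate_def)

lemma out_rate_ge: "out_rate (Q r) s \<ge> lam * r"
  using bet control_rate_nonneg by (cases s) (simp add: out_rate_Q)

lemma locally_finite_Q:
  assumes "r > 0"
  shows "locally_finite_rates (Q r)"
proof
  show "Q r a b \<ge> 0" for a b
    using assms lam bet control_rate_nonneg by (cases a) (auto simp: Q_eq)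
  show "out_rate (Q r) a > 0" for a
    using out_rate_ge[of r a] assms lam by (meson less_le_trans mult_pos_pos)
qed (fact Q_diag finite_Q_succ finite_Q_pred)+

lemma generator_Q:
  "generator (Q r) h (y, x) = lam * r * (h (y - 1, x + gam) - h (y, x))
     + bet * real x * (h (y + 1, x - min gam x) - h (y, x))
     + control_rate y x * (h (y, nat (int x - sgn y)) - h (y, x))"
  unfolding generator_def by (rule sum_Q)

lemma Q_arrival: "r > 0 \<Longrightarrow> Q r (y, x) (y - 1, x + gam) > 0"
  using lam bet control_rate_nonneg[of y x] by (auto simp: Q_eq)

lemma Q_service: "r > 0 \<Longrightarrow> x \<ge> 1 \<Longrightarrow> Q r (y, x) (y + 1, x - min gam x) > 0"
  using lam bet control_rate_nonneg[of y x] by (auto simp: Q_eq)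

lemma Q_control:
  "r > 0 \<Longrightarrow> y \<noteq> 0 \<Longrightarrow> x \<ge> 1 \<or> y < 0 \<Longrightarrow> Q r (y, x) (y, nat (int x - sgn y)) > 0"
  using lam bet eps by (auto simp: Q_eq control_rate_def)

lemma reachable_drain:
  assumes "r > 0" "y > 0"
  shows "reachable (Q r) (y, x) (y, 0)"
proof (induction x)
  case (Suc x)
  show ?case
    by (rule reachable_step[OF _ _ Suc])
       (use Q_control[of r y "Suc x"] assms in \<open>auto simp: sgn_if\<close>)
qed (simp add: reachable_def)

lemma reachable_from_pos:
  assumes "r > 0"
  shows "reachable (Q r) (int (Suc n), x) (1, 0)"
proof (induction n arbitrary: x)
  case 0
  show ?case using reachable_drain[OF assms, of 1 x] by simp
next
  case (Suc n)
  have "reachable (Q r) (int (Suc (Suc n)), 0) (1, 0)"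
    by (rule reachable_step[OF _ _ Suc[of gam]])
       (use Q_arrival[OF assms, of "int (Suc (Suc n))" 0] in auto)
  then show ?case
    by (rule reachable_trans[OF reachable_drain[OF assms], rotated]) simp
qed

lemma reachable_from_nonpos:
  assumes "r > 0" "x \<ge> 1"
  shows "reachable (Q r) (- int n, x) (1, 0)"
  using assms(2)
proof (induction n arbitrary: x)
  case 0
  show ?case
    by (rule reachable_step[OF _ _ reachable_from_pos[OF assms(1), of 0 "x - min gam x"]])
       (use Q_service[OF assms(1), of x 0] 0 in auto)
next
  case (Suc n)
  have big: "reachable (Q r) (- int (Suc n), x) (1, 0)" if "x > gam" for x
    by (rule reachable_step[OF _ _ Suc.IH[of "x - min gam x"]])
       (use Q_service[OF assms(1), of x "- int (Suc n)"] that in auto)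
  have "reachable (Q r) (- int (Suc n), x) (- int (Suc n), x + k)" for k
  proof (induction k arbitrary: x)
    case (Suc k)
    have "reachable (Q r) (- int (Suc n), Suc x) (- int (Suc n), x + Suc k)"
      using Suc[of "Suc x"] by (simp del: of_nat_Suc)
    then show ?case
      by (rule reachable_step[rotated 2])
         (use Q_control[OF assms(1), of "- int (Suc n)" x] in \<open>auto simp: sgn_if nat_add_distrib\<close>)
  qed (simp add: reachable_def)
  from reachable_trans[OF this big[of "x + Suc gam"]] show ?case by simp
qed

lemma reachable_base:
  assumes "r > 0"
  shows "reachable (Q r) s (1, 0)"
proof -
  obtain y x where s: "s = (y, x)" by (cases s)
  show ?thesis
  proof (cases "y > 0")
    case True
    then have "int (Suc (nat (y - 1))) = y" by simp
    with reachable_from_pos[OF assms, of "nat (y - 1)" x] show ?thesis by (simp only: s)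
  next
    case False
    then have "- int (nat (1 - y)) = y - 1" by simp
    with reachable_from_nonpos[OF assms, of "x + gam" "nat (1 - y)"] gam
    have "reachable (Q r) (y - 1, x + gam) (1, 0)" by (simp only:)
    then show ?thesis unfolding s
      by (rule reachable_step[rotated 2]) (use Q_arrival[OF assms] in auto)
  qed
qed

text \<open>Arrivals and services both preserve \<open>\<gamma> u + v\<close>.  The coefficient of \<open>u\<^sup>2\<close> is the one that cancels
  the \<open>u v\<close> terms of the drift.\<close>

definition lyap :: "real \<Rightarrow> int \<times> nat \<Rightarrow> real" where
  "lyap r = (\<lambda>(y, x). (real gam * y + (real x - lam * r / bet))\<^sup>2
     + (real x - lam * r / bet)\<^sup>2 + 2 * eps / bet * (real_of_int y)\<^sup>2)"

definition drift_coeff :: real where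
  "drift_coeff = min (real gam * min bet eps) (2 * real gam * lam\<^sup>2 / bet)"

definition jump_const :: real where
  "jump_const = (real gam)\<^sup>2 + 2 * eps / bet + 1"

definition drift_const :: real where
  "drift_const = 2 * lam * jump_const + 2 * bet * real gam ^ 3
     + (bet * jump_const)\<^sup>2 / (4 * (bet * real gam))
     + (3 * eps + 2 * bet * real gam ^ 3)\<^sup>2 / (4 * (eps * real gam))"

lemma drift_coeff_pos: "drift_coeff > 0"
  using lam bet eps gam by (simp add: drift_coeff_def)

lemma jump_const_pos: "jump_const > 0"
  using bet eps by (simp add: jump_const_def add_nonneg_pos)

lemma drift_const_nonneg: "drift_const \<ge> 0"
  using lam bet eps gam jump_const_pos by (simp add: drift_const_def)

lemma lyap_nonneg: "lyap r s \<ge> 0"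
  using bet eps by (cases s) (simp add: lyap_def)

lemma finite_lyap_level: "finite {s. lyap r s < c}"
proof (rule finite_subset[OF _ finite_lattice_box])
  define k where "k = 2 * eps / bet"
  have k: "k > 0" using bet eps by (simp add: k_def)
  show "{s. lyap r s < c} \<subseteq> {(y :: int, x :: nat). (real_of_int y)\<^sup>2 \<le> max c (c / k) \<and>
      (real x - lam * r / bet)\<^sup>2 \<le> max c (c / k)}"
  proof
    fix s assume "s \<in> {s. lyap r s < c}"
    moreover obtain y x where s: "s = (y, x)" by (cases s)
    ultimately have *: "(real gam * y + (real x - lam * r / bet))\<^sup>2 + (real x - lam * r / bet)\<^sup>2
        + k * (real_of_int y)\<^sup>2 < c" by (simp add: lyap_def k_def)
    have nn: "0 \<le> k * (real_of_int y)\<^sup>2" "0 \<le> (real gam * y + (real x - lam * r / bet))\<^sup>2"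
      "0 \<le> (real x - lam * r / bet)\<^sup>2" using k by auto
    from * nn have "k * (real_of_int y)\<^sup>2 \<le> c" "(real x - lam * r / bet)\<^sup>2 \<le> c"
      by linarith+
    then have "(real_of_int y)\<^sup>2 \<le> c / k" "(real x - lam * r / bet)\<^sup>2 \<le> c"
      using k by (auto simp: field_simps)
    then show "s \<in> {(y, x). (real_of_int y)\<^sup>2 \<le> max c (c / k) \<and>
        (real x - lam * r / bet)\<^sup>2 \<le> max c (c / k)}"
      unfolding s by (auto simp: le_max_iff_disj)
  qed
qed

lemma generator_lyap_interior:
  fixes y :: int and x :: nat and r :: real
  defines "v \<equiv> real x - lam * r / bet" and "u \<equiv> real_of_int y"
  assumes int: "x \<ge> 1 \<or> y \<le> 0" and r: "r > 0"
  shows "generator (Q r) (lyap r) (y, x) \<le> - 2 * bet * gam * v\<^sup>2 - 2 * eps * gam * u\<^sup>2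
     + ((real gam)\<^sup>2 + 2 * eps / bet) * (2 * lam * r + bet * v)
     + 2 * eps * \<bar>u\<bar> + 2 * bet * real gam ^ 3 * (\<bar>u\<bar> + 1)"
proof -
  define m where "m = lam * r / bet"
  define k where "k = 2 * eps / bet"
  define g where "g = real gam"
  have m: "lam * r = bet * m" and k: "eps = bet * k / 2"
    using bet by (auto simp: m_def k_def)
  have x: "real x = v + m" by (simp add: v_def m_def)
  have lyap: "lyap r (y', x') = (g * y' + (real x' - m))\<^sup>2 + (real x' - m)\<^sup>2 + k * (real_of_int y')\<^sup>2"
    for y' x' by (simp add: lyap_def g_def m_def k_def)
  have arrival: "lyap r (y - 1, x + gam) - lyap r (y, x) = 2 * g * v + g\<^sup>2 - 2 * k * u + k"
    unfolding lyap by (simp add: x u_def g_def[symmetric]) (simp add: power2_eq_square algebra_simps)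
  have service: "bet * real x * (lyap r (y + 1, x - min gam x) - lyap r (y, x))
      \<le> bet * (v + m) * (- 2 * g * v + g\<^sup>2 + 2 * k * u + k) + 2 * bet * g ^ 3 * (\<bar>u\<bar> + 1)"
  proof (cases "x \<ge> gam")
    case True
    have "lyap r (y + 1, x - min gam x) - lyap r (y, x) = - 2 * g * v + g\<^sup>2 + 2 * k * u + k"
      using True unfolding lyap
      by (simp add: of_nat_diff x u_def g_def[symmetric]) (simp add: power2_eq_square algebra_simps)
    moreover have "0 \<le> 2 * bet * g ^ 3 * (\<bar>u\<bar> + 1)" using bet by (simp add: g_def)
    ultimately show ?thesis by (simp add: x)
  next
    case False
    define d where "d = g - real x"
    have d: "0 < d" "d \<le> g" using False by (auto simp: d_def g_def)
    have m0: "v = g - d - m" by (simp add: v_def d_def m_def)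
    define D where "D = 2 * d * (g * (u + 1)) - 4 * d * m - 2 * d\<^sup>2"
    define E where "E = - 2 * g * v + g\<^sup>2 + 2 * k * u + k"
    have "lyap r (y + 1, x - min gam x) - lyap r (y, x)
        - (- 2 * g * v + g\<^sup>2 + 2 * k * u + k) = 2 * d * (g * (u + 1) - m) - d\<^sup>2 + m\<^sup>2 - (m + d)\<^sup>2"
      using False unfolding lyap
      by (simp add: x u_def min_def) (simp add: m0 power2_eq_square algebra_simps)
    also have "\<dots> = 2 * d * (g * (u + 1)) - 4 * d * m - 2 * d\<^sup>2"
      by (simp add: power2_eq_square algebra_simps)
    finally have eq: "lyap r (y + 1, x - min gam x) - lyap r (y, x) = E + D"
      by (simp add: D_def E_def)
    have "d * (g * (u + 1)) \<le> g * (g * (\<bar>u\<bar> + 1))"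
    proof -
      have "d * (g * (u + 1)) \<le> d * (g * (\<bar>u\<bar> + 1))"
        using d by (intro mult_left_mono) (auto simp: g_def)
      also have "\<dots> \<le> g * (g * (\<bar>u\<bar> + 1))"
        using d by (intro mult_right_mono) auto
      finally show ?thesis .
    qed
    moreover have "0 \<le> d * m" using d lam bet r by (simp add: m_def)
    moreover have "0 \<le> d\<^sup>2" by simp
    ultimately have "D \<le> 2 * (g * (g * (\<bar>u\<bar> + 1)))"
      unfolding D_def by linarith
    then have "bet * real x * D
        \<le> bet * g * (2 * (g * (g * (\<bar>u\<bar> + 1))))"
      using bet d by (intro order_trans[OF mult_left_mono mult_right_mono]) (auto simp: d_def g_def)
    also have "\<dots> = 2 * bet * g ^ 3 * (\<bar>u\<bar> + 1)" by (simp add: power3_eq_cube)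
    finally show ?thesis
      unfolding eq E_def[symmetric] x[symmetric] by (simp add: distrib_left)
  qed
  have control: "control_rate y x * (lyap r (y, nat (int x - sgn y)) - lyap r (y, x))
      = - 2 * eps * u * (g * u + 2 * v) + 2 * eps * \<bar>u\<bar>"
  proof -
    consider "y = 0" | "y > 0" "x \<ge> 1" | "y < 0" using int by linarith
    then show ?thesis
    proof cases
      case 2
      then have "real (nat (int x - sgn y)) = v + m - 1" by (simp add: x[symmetric] sgn_if nat_diff_distrib')
      with 2 show ?thesis unfolding lyap control_rate_def
        by (simp add: x u_def) (simp add: power2_eq_square algebra_simps)
    next
      case 3
      then have "real (nat (int x - sgn y)) = v + m + 1" by (simp add: x[symmetric] sgn_if nat_add_distrib)
      with 3 show ?thesis unfolding lyap control_rate_def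
        by (simp add: x u_def) (simp add: power2_eq_square algebra_simps)
    qed (simp add: control_rate_def u_def)
  qed
  have "lam * r * (2 * g * v + g\<^sup>2 - 2 * k * u + k) + bet * (v + m) * (- 2 * g * v + g\<^sup>2 + 2 * k * u + k)
      - 2 * eps * u * (g * u + 2 * v) =
      - 2 * bet * g * v\<^sup>2 - 2 * eps * g * u\<^sup>2 + (g\<^sup>2 + k) * (2 * (lam * r) + bet * v)"
    unfolding m k by (simp add: power2_eq_square algebra_simps)
  with service show ?thesis
    unfolding generator_Q arrival control g_def[symmetric] k_def[symmetric] by (simp add: mult.assoc)
qed

lemma generator_lyap_boundary:
  assumes "y > 0"
  shows "generator (Q r) (lyap r) (y, 0) =
     lam * r * (- 2 * gam * (lam * r / bet) - 4 * eps / bet * y + (real gam)\<^sup>2 + 2 * eps / bet)"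
proof -
  have "lyap r (y - 1, 0 + gam) - lyap r (y, 0) =
      - 2 * gam * (lam * r / bet) - 4 * eps / bet * y + (real gam)\<^sup>2 + 2 * eps / bet"
    unfolding lyap_def
    by (simp add: power2_eq_square algebra_simps add_divide_distrib diff_divide_distrib)
  then show ?thesis using assms unfolding generator_Q by (simp add: control_rate_def)
qed

lemma drift_interior:
  fixes y :: int and x :: nat and r :: real
  assumes int: "x \<ge> 1 \<or> y \<le> 0" and r: "r > 0"
  shows "generator (Q r) (lyap r) (y, x) + out_rate (Q r) (y, x)
     \<le> drift_const * (r + 1) - drift_coeff * ((real_of_int y)\<^sup>2 + (real x - lam * r / bet)\<^sup>2)"
proof -
  define v where "v = real x - lam * r / bet"
  define u where "u = real_of_int y"
  define g where "g = real gam"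
  define j where "j = jump_const"
  have g: "g \<ge> 1" using gam by (simp add: g_def)
  have "out_rate (Q r) (y, x) \<le> lam * r + bet * x + eps * \<bar>u\<bar>"
    using eps unfolding out_rate_Q by (simp add: control_rate_def u_def)
  also have "\<dots> = 2 * lam * r + bet * v + eps * \<bar>u\<bar>"
    using bet by (simp add: v_def field_simps)
  finally have "generator (Q r) (lyap r) (y, x) + out_rate (Q r) (y, x)
      \<le> - 2 * bet * g * v\<^sup>2 - 2 * eps * g * u\<^sup>2 + j * (2 * lam * r + bet * v)
        + 2 * eps * \<bar>u\<bar> + 2 * bet * g ^ 3 * (\<bar>u\<bar> + 1) + eps * \<bar>u\<bar>"
    using generator_lyap_interior[OF int r]
    unfolding v_def[symmetric] u_def[symmetric] g_def[symmetric] j_def jump_const_def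
    by (simp add: algebra_simps)
  also have "\<dots> = - 2 * (bet * g * v\<^sup>2) - 2 * (eps * g * u\<^sup>2) + bet * j * v
        + (3 * eps + 2 * bet * g ^ 3) * \<bar>u\<bar> + 2 * lam * j * r + 2 * bet * g ^ 3"
    by (simp add: algebra_simps)
  finally have 1: "generator (Q r) (lyap r) (y, x) + out_rate (Q r) (y, x) \<le> \<dots>" .
  have 2: "bet * j * v \<le> bet * g * v\<^sup>2 + (bet * j)\<^sup>2 / (4 * (bet * g))"
  proof -
    have "bet * j * v \<le> bet * j * \<bar>v\<bar>" using bet jump_const_pos by (intro mult_left_mono) (auto simp: j_def)
    also have "\<dots> \<le> bet * g * v\<^sup>2 + (bet * j)\<^sup>2 / (4 * (bet * g))"
      using bet g by (intro linear_le_square) auto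
    finally show ?thesis .
  qed
  have 3: "(3 * eps + 2 * bet * g ^ 3) * \<bar>u\<bar> \<le> eps * g * u\<^sup>2 + (3 * eps + 2 * bet * g ^ 3)\<^sup>2 / (4 * (eps * g))"
    using eps g by (intro linear_le_square) auto
  have 4: "drift_coeff * (u\<^sup>2 + v\<^sup>2) \<le> bet * g * v\<^sup>2 + eps * g * u\<^sup>2"
  proof -
    have "drift_coeff \<le> g * min bet eps" by (simp add: drift_coeff_def g_def)
    moreover have "g * min bet eps \<le> g * bet" "g * min bet eps \<le> g * eps"
      using g by (auto intro: mult_left_mono)
    ultimately have "drift_coeff \<le> bet * g" "drift_coeff \<le> eps * g" by (auto simp: mult.commute)
    then have "drift_coeff * v\<^sup>2 \<le> bet * g * v\<^sup>2" "drift_coeff * u\<^sup>2 \<le> eps * g * u\<^sup>2"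
      by (auto intro: mult_right_mono)
    then show ?thesis by (simp add: algebra_simps)
  qed
  define A1 where "A1 = (bet * j)\<^sup>2 / (4 * (bet * g))"
  define A2 where "A2 = (3 * eps + 2 * bet * g ^ 3)\<^sup>2 / (4 * (eps * g))"
  have "0 \<le> A1" "0 \<le> A2" "0 \<le> 2 * bet * g ^ 3" "0 \<le> 2 * lam * j"
    using lam bet eps g jump_const_pos by (auto simp: A1_def A2_def j_def)
  then have nn: "0 \<le> (A1 + A2 + 2 * bet * g ^ 3) * r" "0 \<le> 2 * lam * j" using r by auto
  have "drift_const * (r + 1) = (2 * lam * j + 2 * bet * g ^ 3 + A1 + A2) * (r + 1)"
    by (simp add: drift_const_def A1_def A2_def j_def g_def)
  also have "\<dots> = 2 * lam * j * r + 2 * bet * g ^ 3 + A1 + A2 + (A1 + A2 + 2 * bet * g ^ 3) * r + 2 * lam * j"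
    by (simp add: algebra_simps)
  finally have 5: "2 * lam * j * r + 2 * bet * g ^ 3 + A1 + A2 \<le> drift_const * (r + 1)" using nn by linarith
  show ?thesis
    using 1 2 3 4 5 unfolding v_def[symmetric] u_def[symmetric] A1_def[symmetric] A2_def[symmetric]
    by linarith
qed

lemma drift_boundary:
  fixes y :: int and r :: real
  assumes y: "y > 0" and r: "r > 0"
  shows "generator (Q r) (lyap r) (y, 0) + out_rate (Q r) (y, 0)
     \<le> drift_const * (r + 1) - drift_coeff * r\<^sup>2 - lam * r * (4 * eps / bet) * y"
proof -
  have "generator (Q r) (lyap r) (y, 0) + out_rate (Q r) (y, 0)
      = lam * r * jump_const - 2 * gam * lam\<^sup>2 / bet * r\<^sup>2 - lam * r * (4 * eps / bet) * y"
    unfolding generator_lyap_boundary[OF y] out_rate_Q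
    using y by (simp add: control_rate_def jump_const_def power2_eq_square algebra_simps)
  moreover have "drift_coeff * r\<^sup>2 \<le> 2 * gam * lam\<^sup>2 / bet * r\<^sup>2"
    by (intro mult_right_mono) (auto simp: drift_coeff_def)
  moreover have "lam * r * jump_const \<le> drift_const * (r + 1)"
  proof -
    have "lam * jump_const \<le> drift_const"
      using lam bet eps gam jump_const_pos unfolding drift_const_def by (simp add: add.assoc add_increasing2)
    then have "lam * jump_const * r \<le> drift_const * (r + 1)"
      using r drift_const_nonneg by (intro mult_mono) auto
    then show ?thesis by (simp add: mult_ac)
  qed
  ultimately show ?thesis by linarith
qed

lemma drift_bound:
  assumes r: "r > 0"
  shows "generator (Q r) (lyap r) s \<le> drift_const * (r + 1) - drift_coeff * r\<^sup>2 * min ((norm (fluid_scale lam bet r s))\<^sup>2) 1"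
proof -
  obtain y x where s: "s = (y, x)" by (cases s)
  have out: "out_rate (Q r) s \<ge> 0" using out_rate_ge[of r s] lam r by (smt (verit) mult_pos_pos)
  show ?thesis
  proof (cases "x \<ge> 1 \<or> y \<le> 0")
    case True
    have "(norm (fluid_scale lam bet r s))\<^sup>2 = ((real_of_int y)\<^sup>2 + (real x - lam * r / bet)\<^sup>2) / r\<^sup>2"
      by (simp add: s fluid_scale_def norm_Pair power_divide add_divide_distrib)
    then have "r\<^sup>2 * (norm (fluid_scale lam bet r s))\<^sup>2 = (real_of_int y)\<^sup>2 + (real x - lam * r / bet)\<^sup>2"
      using r by simp
    moreover have "drift_coeff * (r\<^sup>2 * min ((norm (fluid_scale lam bet r s))\<^sup>2) 1)
        \<le> drift_coeff * (r\<^sup>2 * (norm (fluid_scale lam bet r s))\<^sup>2)"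
      using drift_coeff_pos by (intro mult_left_mono) auto
    ultimately show ?thesis using drift_interior[OF True r] out by (simp add: s mult.assoc)
  next
    case False
    then have x: "x = 0" and y: "y > 0" by auto
    have "0 \<le> lam * r * (4 * eps / bet) * y" using lam bet eps r y by simp
    moreover have "drift_coeff * r\<^sup>2 * min ((norm (fluid_scale lam bet r s))\<^sup>2) 1 \<le> drift_coeff * r\<^sup>2 * 1"
      using drift_coeff_pos by (intro mult_left_mono) auto
    ultimately show ?thesis using drift_boundary[OF y r] out by (simp add: s x)
  qed
qed

lemma pos_recurrent_Q:
  assumes r: "r > 0"
  shows "pos_recurrent (Q r)"
proof -
  interpret locally_finite_rates "Q r" by (rule locally_finite_Q[OF r])
  define F where "F = {s. \<not> generator (Q r) (lyap r) s \<le> - out_rate (Q r) s}"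
  define m where "m = lam * r / bet"
  define b where "b = lam * r * (4 * eps / bet)"
  define C where "C = drift_const * (r + 1)"
  have b: "b > 0" using lam bet eps r by (simp add: b_def)
  have "F \<subseteq> {(y, x). (real_of_int y)\<^sup>2 \<le> C / drift_coeff \<and> (real x - m)\<^sup>2 \<le> C / drift_coeff}
      \<union> {0..\<lceil>C / b\<rceil>} \<times> {0}"
  proof
    fix s assume s: "s \<in> F"
    obtain y x where yx: "s = (y, x)" by (cases s)
    have pos: "generator (Q r) (lyap r) (y, x) + out_rate (Q r) (y, x) > 0"
      using s by (simp add: F_def yx)
    show "s \<in> {(y, x). (real_of_int y)\<^sup>2 \<le> C / drift_coeff \<and> (real x - m)\<^sup>2 \<le> C / drift_coeff}
        \<union> {0..\<lceil>C / b\<rceil>} \<times> {0}"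
    proof (cases "x \<ge> 1 \<or> y \<le> 0")
      case True
      then have "drift_coeff * ((real_of_int y)\<^sup>2 + (real x - m)\<^sup>2) \<le> C"
        using drift_interior[OF True r] pos by (simp add: C_def m_def)
      then have *: "(real_of_int y)\<^sup>2 + (real x - m)\<^sup>2 \<le> C / drift_coeff"
        using drift_coeff_pos by (simp add: field_simps)
      have "0 \<le> (real_of_int y)\<^sup>2" "0 \<le> (real x - m)\<^sup>2" by auto
      with * have "(real_of_int y)\<^sup>2 \<le> C / drift_coeff" "(real x - m)\<^sup>2 \<le> C / drift_coeff" by linarith+
      then show ?thesis by (simp add: yx)
    next
      case False
      then have x: "x = 0" and y: "y > 0" by auto
      have "0 \<le> drift_coeff * r\<^sup>2" using drift_coeff_pos by simp
      with drift_boundary[OF y r] pos have "b * y \<le> C" by (simp add: x b_def C_def)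
      then have "y \<le> C / b" using b by (simp add: field_simps)
      then have "y \<le> \<lceil>C / b\<rceil>" by linarith
      with x y show ?thesis by (auto simp: yx)
    qed
  qed
  then have "finite F" by (rule finite_subset) (use finite_lattice_box in auto)
  from lyap_nonneg this show ?thesis
    by (rule foster_criterion[where s = "(1, 0)" and q = "lam * r"])
       (use reachable_base[OF r] out_rate_ge lam r in \<open>auto simp: F_def\<close>)
qed

lemma stationary_truncated_second_moment:
  assumes r: "r > 0" and \<pi>: "stationary_dist (Q r) \<pi>"
  defines "G \<equiv> \<lambda>s. min ((norm (fluid_scale lam bet r s))\<^sup>2) 1"
  shows "(\<lambda>s. \<pi> s * G s) summable_on UNIV"
    and "(\<Sum>\<^sub>\<infinity>s. \<pi> s * G s) \<le> drift_const * (r + 1) / (drift_coeff * r\<^sup>2)"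
proof -
  interpret locally_finite_rates "Q r" by (rule locally_finite_Q[OF r])
  have c: "drift_coeff * r\<^sup>2 > 0" using drift_coeff_pos r by simp
  have *: "(\<lambda>s. \<pi> s * (drift_coeff * r\<^sup>2 * G s)) summable_on UNIV"
    "(\<Sum>\<^sub>\<infinity>s. \<pi> s * (drift_coeff * r\<^sup>2 * G s)) \<le> drift_const * (r + 1)"
    using stationary_drift_bound[OF \<pi> finite_lyap_level, of "\<lambda>s. drift_coeff * r\<^sup>2 * G s" r "drift_const * (r + 1)"]
      drift_bound[OF r] c drift_const_nonneg r by (auto simp: G_def)
  have eq: "\<pi> s * (drift_coeff * r\<^sup>2 * G s) = (drift_coeff * r\<^sup>2) * (\<pi> s * G s)" for s by simp
  show "(\<lambda>s. \<pi> s * G s) summable_on UNIV"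
    using *(1) c unfolding eq by (subst (asm) summable_on_cmult_right') auto
  show "(\<Sum>\<^sub>\<infinity>s. \<pi> s * G s) \<le> drift_const * (r + 1) / (drift_coeff * r\<^sup>2)"
    using *(2) c unfolding eq infsum_cmult_right' by (simp add: field_simps)
qed

lemma stationary_weak_limit:
  fixes f :: "real \<times> real \<Rightarrow> real"
  assumes \<pi>: "\<And>r. r \<ge> 1 \<Longrightarrow> stationary_dist (Q r) (\<pi> r)"
    and f: "continuous_on UNIV f" "bounded (range f)"
  shows "((\<lambda>r. \<Sum>\<^sub>\<infinity>s. \<pi> r s * f (fluid_scale lam bet r s)) \<longlongrightarrow> f (0, 0)) at_top"
proof (rule tendstoI)
  fix e :: real assume e: "e > 0"
  obtain M where M: "\<And>p. \<bar>f p\<bar> \<le> M" using f(2) by (auto simp: bounded_iff)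
  have "isCont f 0" using f(1) continuous_on_eq_continuous_at[OF open_UNIV] by blast
  then have "\<exists>d>0. \<forall>p. dist p 0 < d \<longrightarrow> dist (f p) (f 0) < e / 2"
    using half_gt_zero[OF e] unfolding continuous_at_eps_delta by blast
  then obtain \<delta> where \<delta>: "\<delta> > 0" "\<And>p. norm p < \<delta> \<Longrightarrow> \<bar>f p - f 0\<bar> < e / 2"
    unfolding dist_norm real_norm_def diff_zero by blast
  define c where "c = 2 * M / min (\<delta>\<^sup>2) 1"
  have "((\<lambda>r. c * drift_const / drift_coeff * (inverse r + inverse r * inverse r)) \<longlongrightarrow> c * drift_const / drift_coeff * (0 + 0 * 0)) at_top"
    by (intro tendsto_intros tendsto_inverse_0_at_top filterlim_ident)
  then have "\<forall>\<^sub>F r in at_top. c * drift_const / drift_coeff * (inverse r + inverse r * inverse r) < e / 2"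
    by (rule order_tendstoD) (use e in auto)
  then show "\<forall>\<^sub>F r in at_top. dist (\<Sum>\<^sub>\<infinity>s. \<pi> r s * f (fluid_scale lam bet r s)) (f (0, 0)) < e"
    using eventually_ge_at_top[of 1]
  proof eventually_elim
    case (elim r)
    then have r: "r > 0" by simp
    have st: "stationary_dist (Q r) (\<pi> r)" using \<pi> elim by simp
    have "\<bar>(\<Sum>\<^sub>\<infinity>s. \<pi> r s * f (fluid_scale lam bet r s)) - f 0\<bar>
        \<le> e / 2 + 2 * M / min (\<delta>\<^sup>2) 1 * (drift_const * (r + 1) / (drift_coeff * r\<^sup>2))"
      by (rule expectation_deviation_bound[OF _ _ stationary_truncated_second_moment[OF r st] M])
         (use st \<delta> e in \<open>auto simp: stationary_dist_def intro: less_imp_le\<close>)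
    also have "2 * M / min (\<delta>\<^sup>2) 1 * (drift_const * (r + 1) / (drift_coeff * r\<^sup>2))
        = c * drift_const / drift_coeff * (inverse r + inverse r * inverse r)"
      unfolding c_def[symmetric] using r drift_coeff_pos by (simp add: field_simps power2_eq_square)
    also have "e / 2 + \<dots> < e" using elim(1) by linarith
    finally show ?case by (simp add: dist_real_def zero_prod_def)
  qed
qed

end

theorem theorem2:
  fixes lam bet eps :: real and gam :: nat
  assumes "lam > 0" and "bet > 0" and "eps > 0" and "gam > 0"
    and "eps < (real gam)^2 * bet / 4"
  shows "\<exists>R>0. (\<forall>r\<ge>R. pos_recurrent (model_rate lam bet eps gam r)) \<and>
     (\<forall>\<pi> :: real \<Rightarrow> int \<times> nat \<Rightarrow> real.
        (\<forall>r\<ge>R. stationary_dist (model_rate lam bet eps gam r) (\<pi> r)) \<longrightarrow>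
        (\<forall>f :: real \<times> real \<Rightarrow> real. continuous_on UNIV f \<and> bounded (range f) \<longrightarrow>
           ((\<lambda>r. \<Sum>\<^sub>\<infinity> s. \<pi> r s * f (fluid_scale lam bet r s)) \<longlongrightarrow> f (0, 0)) at_top))"
proof -
  interpret feedback_model lam bet eps gam by unfold_locales (fact assms)+
  show ?thesis
  proof (intro exI[of _ 1] conjI allI impI)
    show "pos_recurrent (Q r)" if "1 \<le> r" for r
      using that by (intro pos_recurrent_Q) simp
  qed (simp, rule stationary_weak_limit, auto)
qed

end
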